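(* Let $G$ be a closed group with $\operatorname{GL}(\omega,2)\lneqq G\leq\operatorname{Sym}(\mathbb{F}_2^\omega)$ that does not fix $0$. Then $G=\operatorname{AGL}$ or $G=\operatorname{Sym}(\mathbb{F}_2^\omega)$.
   Context: $\mathbb{F}_2^\omega$ denotes the countably infinite dimensional vector space over the two element field, $\operatorname{GL}(\omega,2)$ its automorphism group, and $\operatorname{Sym}(\mathbb{F}_2^\omega)$ the group of all permutations of its elements. $\operatorname{AGL}$ is the subgroup of $\operatorname{Sym}(\mathbb{F}_2^\omega)$ generated by $\operatorname{GL}(\omega,2)$ and all translations $v\mapsto v+a$ ($a\in\mathbb{F}_2^\omega$). A subgroup $H\le \operatorname{Sym}(\Omega)$ is closed if it is closed in the topology of pointwise convergence: whenever $\pi\in\operatorname{Sym}(\Omega)$ is such that for every finite $S\subset\Omega$ there is $\sigma_S\in H$ with $\sigma_S|_S=\pi|_S$, then $\pi\in H$. *)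

theory Defs
  imports Complex_Main "HOL-Library.Z2" "HOL-Library.Countable_Set"
    "HOL-Algebra.Bij" "HOL-Algebra.Generated_Groups"
begin

text \<open>
  The space is taken up to isomorphism: any vector space over the two element field \<^typ>\<open>bit\<close>
  (filling the type \<open>'v\<close>) with a countably infinite basis. The library's \<open>dim\<close> is a natural
  number and cannot express this.
\<close>

definition countably_infinite_dimensional :: "(bit \<Rightarrow> 'v::ab_group_add \<Rightarrow> 'v) \<Rightarrow> bool" where
  "countably_infinite_dimensional scale \<longleftrightarrow>
     vector_space scale \<and>
     (\<exists>B. \<not> module.dependent scale B \<and> module.span scale B = UNIV \<and> countable B \<and> infinite B)"

abbreviation Sym :: "('v \<Rightarrow> 'v) monoid" where
  "Sym \<equiv> BijGroup UNIV"

definition GL :: "(bit \<Rightarrow> 'v::ab_group_add \<Rightarrow> 'v) \<Rightarrow> ('v \<Rightarrow> 'v) set" where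
  "GL scale = {f. Vector_Spaces.linear scale scale f \<and> bij f}"

definition translation_maps :: "('v::ab_group_add \<Rightarrow> 'v) set" where
  "translation_maps = {\<lambda>v. v + a | a. True}"

definition AGL :: "(bit \<Rightarrow> 'v::ab_group_add \<Rightarrow> 'v) \<Rightarrow> ('v \<Rightarrow> 'v) set" where
  "AGL scale = generate Sym (GL scale \<union> translation_maps)"

definition closed_in_Sym :: "('v \<Rightarrow> 'v) set \<Rightarrow> bool" where
  "closed_in_Sym H \<longleftrightarrow>
     (\<forall>\<pi>\<in>carrier Sym. (\<forall>S. finite S \<longrightarrow> (\<exists>\<sigma>\<in>H. \<forall>x\<in>S. \<sigma> x = \<pi> x)) \<longrightarrow> \<pi> \<in> H)"

end

theory Submission imports Defs begin

text \<open>
  Suppose that \<open>G\<close> can move every \<open>n\<close>-set to an independent set, and call \<open>w\<close> a bad point of an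
  \<open>n\<close>-set \<open>A\<close> if \<open>A \<union> {w}\<close> cannot be moved to an independent set. Bad points are
  \<open>G\<close>-equivariant, and since badness depends only on the set \<open>A \<union> {w}\<close>, each element of
  \<open>A \<union> {w}\<close> is a bad point of the rest. A bad point of \<open>A\<close> lies in the span of \<open>A\<close>, so an
  independent \<open>A\<close> has at most the bad point \<open>\<Sum>A\<close>. Hence either no \<open>n\<close>-set has a bad point, and
  the supposition holds for \<open>n + 1\<close>, or each has exactly one. The sets \<open>{0}\<close> and \<open>{0, x}\<close> have none
  because they equal their span. For \<open>n = 3\<close>, if bad points exist, the bad point of \<open>{x, y, z}\<close>
  is always \<open>x + y + z\<close>, so \<open>G\<close> consists of affine maps and equals \<open>AGL\<close>. For \<open>n \<ge> 4\<close>, a set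
  consisting of \<open>n - 1\<close> vectors with sum zero as their only relation and one vector independent
  of them has too many symmetries in \<open>GL\<close> for a unique bad point. So if there are no bad points for
  \<open>n = 3\<close>, then \<open>G\<close> is \<open>n\<close>-transitive for all \<open>n\<close>, and being closed it is the full symmetric group.
\<close>

section \<open>Linear algebra over the two element field\<close>

locale bit_space = vector_space scale
  for scale :: "bit \<Rightarrow> 'v::ab_group_add \<Rightarrow> 'v"
begin

lemma add_self [simp]: "x + x = (0::'v)"
  using scale_left_distrib[of 1 1 x] by simp

lemma uminus_eq [simp]: "- x = (x::'v)"
  by (rule minus_unique) simp

lemma diff_eq_add [simp]: "x - y = x + (y::'v)"
  using diff_conv_add_uminus[of x y] by simp

lemma add_self_left [simp]: "x + (x + y) = (y::'v)"
  by (simp flip: add.assoc)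

lemma add_eq_iff: "x + y = z \<longleftrightarrow> x = z + (y::'v)"
  by (metis diff_eq_add eq_diff_eq)

lemma add_eq_0_iff_eq [simp]: "x + y = (0::'v) \<longleftrightarrow> x = y"
  by (simp add: add_eq_iff)

lemma additive_imp_linear:
  assumes "\<And>x y. f (x + y) = f x + f y"
  shows "Vector_Spaces.linear scale scale f"
proof -
  have "f 0 = 0" using assms[of 0 0] by simp
  then have "f (scale c x) = scale c (f x)" for c x by (cases c) auto
  then show ?thesis
    using assms by (simp add: Vector_Spaces.linear_iff vector_space_axioms)
qed

lemma span_finite_eq_subset_sums:
  assumes "finite A"
  shows "span A = {\<Sum>I | I. I \<subseteq> A}"
proof (intro equalityI subsetI)
  fix x assume "x \<in> span A"
  then obtain u where x: "x = (\<Sum>v\<in>A. scale (u v) v)"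
    using span_finite[OF assms] by auto
  have "scale (u v) v = (if u v = 1 then v else 0)" for v by (cases "u v") auto
  then have "x = \<Sum>{v\<in>A. u v = 1}"
    by (simp add: x sum.inter_filter[OF assms])
  then show "x \<in> {\<Sum>I | I. I \<subseteq> A}" by blast
next
  fix x assume "x \<in> {\<Sum>I | I. I \<subseteq> A}"
  then show "x \<in> span A" by (auto intro!: span_sum intro: span_base)
qed

lemma span_insert_iff: "x \<in> span (insert a A) \<longleftrightarrow> x \<in> span A \<or> x + a \<in> span A"
proof
  assume "x \<in> span (insert a A)"
  then obtain k where "x - scale k a \<in> span A" using span_breakdown_eq by blast
  then show "x \<in> span A \<or> x + a \<in> span A" by (cases k) auto
next
  assume "x \<in> span A \<or> x + a \<in> span A"
  then have "x - scale 0 a \<in> span A \<or> x - scale 1 a \<in> span A" by simp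
  then show "x \<in> span (insert a A)" unfolding span_breakdown_eq by blast
qed

lemma span_pair: "v \<in> span {a, b} \<longleftrightarrow> v = 0 \<or> v = a \<or> v = b \<or> v = a + b"
proof -
  have "v + a = b \<longleftrightarrow> v = a + b" by (simp only: add_eq_iff[of v a] add.commute[of a])
  then show ?thesis by (auto simp: span_insert_iff)
qed

lemma span_triple:
  "v \<in> span {a, b, c} \<longleftrightarrow>
    v = 0 \<or> v = a \<or> v = b \<or> v = c \<or> v = a + b \<or> v = a + c \<or> v = b + c \<or> v = a + b + c"
proof -
  have "v + a = d \<longleftrightarrow> v = a + d" for d by (simp only: add_eq_iff[of v a] add.commute[of a])
  then show ?thesis
    unfolding span_insert_iff[of v a] span_pair by (auto simp: add.assoc)
qed

lemma linear_functional_extend: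
  fixes \<phi> :: "'v \<Rightarrow> bit"
  assumes "independent B"
  obtains g where "\<And>x y. g (x + y) = g x + g y" "\<And>x. x \<in> B \<Longrightarrow> g x = \<phi> x"
proof -
  interpret bit1: vector_space "(*) :: bit \<Rightarrow> bit \<Rightarrow> bit"
    by unfold_locales (auto simp: algebra_simps)
  interpret vector_space_pair scale "(*) :: bit \<Rightarrow> bit \<Rightarrow> bit" ..
  obtain g where "Vector_Spaces.linear scale (*) g" "\<forall>x\<in>B. g x = \<phi> x"
    using linear_independent_extend[OF assms] by blast
  then show thesis using that Vector_Spaces.linear_iff by blast
qed

lemma separating_functional:
  assumes "x \<notin> span A" "y \<notin> span A"
  obtains \<phi> :: "'v \<Rightarrow> bit" where "\<And>u v. \<phi> (u + v) = \<phi> u + \<phi> v"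
    "\<And>a. a \<in> span A \<Longrightarrow> \<phi> a = 0" "\<phi> x = 1" "\<phi> y = 1"
proof -
  obtain B where B: "B \<subseteq> A" "independent B" "A \<subseteq> span B"
    using maximal_independent_subset .
  have sp: "span B = span A"
    using B by (metis span_eq span_superset subset_trans)
  \<comment> \<open>If \<open>y\<close> lies in the span of \<open>x\<close> and \<open>B\<close>,
    its value is already forced by theirs, so it is left out; this covers \<open>x = y\<close>
    too.\<close>
  define C where "C = (if y \<in> span (insert x B) then insert x B else insert y (insert x B))"
  have C: "independent C"
    using B(2) assms sp by (auto simp: C_def independent_insert)
  obtain \<phi> :: "'v \<Rightarrow> bit" where add: "\<And>u v. \<phi> (u + v) = \<phi> u + \<phi> v"
    and \<phi>: "\<And>v. v \<in> C \<Longrightarrow> \<phi> v = of_bool (v = x \<or> v = y)"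
    by (rule linear_functional_extend[OF C, of "\<lambda>v. of_bool (v = x \<or> v = y)"]) (rule that)
  have x: "\<phi> x = 1" using \<phi>[of x] by (simp add: C_def)
  have zero: "\<phi> 0 = 0" using add[of 0 0] by simp
  have base: "\<phi> b = 0" if "b \<in> B" for b
    using that \<phi>[of b] assms sp span_base[of b B] by (auto simp: C_def)
  have ann: "\<phi> a = 0" if "a \<in> span A" for a
  proof -
    have "a \<in> span B" using that sp by simp
    then show ?thesis
    proof (induction rule: span_induct_alt)
      case base
      show ?case by (rule zero)
    next
      case (step c b v)
      then show ?case using base zero by (cases c) (auto simp: add)
    qed
  qed
  have y: "\<phi> y = 1"
  proof (cases "y \<in> span (insert x B)")
    case True
    then have "y + x \<in> span A" using assms sp by (simp add: span_insert_iff)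
    then have "\<phi> (y + x) = 0" by (rule ann)
    then show ?thesis using add[of y x] x by (cases "\<phi> y") auto
  next
    case False
    then show ?thesis using \<phi>[of y] by (simp add: C_def)
  qed
  show thesis using that add ann x y by blast
qed

text \<open>The map is the transvection \<open>v \<mapsto> v + \<phi>(v)(x + y)\<close>, an involution because \<open>\<phi>(x + y) = 0\<close>.\<close>

lemma GL_fix_span_move:
  assumes "x \<notin> span A" "y \<notin> span A"
  obtains f where "f \<in> GL scale" "\<And>a. a \<in> span A \<Longrightarrow> f a = a" "f x = y"
proof -
  obtain \<phi> :: "'v \<Rightarrow> bit" where \<phi>: "\<And>u v. \<phi> (u + v) = \<phi> u + \<phi> v"
    "\<And>a. a \<in> span A \<Longrightarrow> \<phi> a = 0" "\<phi> x = 1" "\<phi> y = 1"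
    by (rule separating_functional[OF assms]) (rule that)
  define f where "f v = v + scale (\<phi> v) (x + y)" for v
  have "Vector_Spaces.linear scale scale f"
    by (rule additive_imp_linear) (simp only: f_def \<phi>(1) scale_left_distrib ac_simps)
  moreover have "\<phi> (scale c (x + y)) = 0" for c
    using \<phi>(1)[of x y] \<phi>(2)[OF span_zero] \<phi>(3,4) by (cases c) auto
  then have "f (f v) = v" for v
    by (simp add: f_def \<phi>(1) add.assoc)
  then have "bij f" by (rule involuntory_imp_bij)
  ultimately have "f \<in> GL scale" by (simp add: GL_def)
  then show thesis
    using that[of f] \<phi> by (simp add: f_def)
qed

section \<open>Automorphisms and their action on finite independent sets\<close>

lemma id_GL: "id \<in> GL scale"
  by (simp add: GL_def additive_imp_linear)

lemma GL_comp:
  assumes "f \<in> GL scale" "g \<in> GL scale"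
  shows "g \<circ> f \<in> GL scale"
  using assms unfolding GL_def by (auto intro: Vector_Spaces.linear_compose bij_comp)

lemma GL_add: "f \<in> GL scale \<Longrightarrow> f (x + y) = f x + f y"
  by (simp add: GL_def Vector_Spaces.linear_iff)

lemma GL_0: "f \<in> GL scale \<Longrightarrow> f 0 = 0"
  using GL_add[of f 0 0] by simp

lemma GL_inj: "f \<in> GL scale \<Longrightarrow> inj_on f S"
  unfolding GL_def using bij_is_inj[of f] inj_on_subset[of f UNIV S] by blast

lemma GL_span:
  assumes "f \<in> GL scale"
  shows "span (f ` S) = f ` span S"
proof -
  interpret f: Vector_Spaces.linear scale scale f using assms by (simp add: GL_def)
  show ?thesis by (rule f.span_image)
qed

lemma GL_sum:
  assumes "f \<in> GL scale"
  shows "f (\<Sum>S) = \<Sum>(f ` S)"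
proof -
  interpret f: Vector_Spaces.linear scale scale f using assms by (simp add: GL_def)
  show ?thesis by (simp add: f.sum sum.reindex[OF GL_inj[OF assms]])
qed

lemma GL_independent:
  assumes "f \<in> GL scale" "independent S"
  shows "independent (f ` S)"
proof -
  interpret f: Vector_Spaces.linear scale scale f using assms by (simp add: GL_def)
  show ?thesis using assms GL_inj f.independent_inj_on_image by blast
qed

text \<open>One vector is treated at a time: an automorphism correct on \<open>A\<close> sends the
  new \<open>a\<close> outside the span of the images already placed, and a map fixing that span
  then corrects the image of \<open>a\<close>. Composing automorphisms keeps the result
  bijective.\<close>

lemma GL_extend:
  assumes "finite A" "independent A" "independent (\<psi> ` A)" "inj_on \<psi> A"
  obtains f where "f \<in> GL scale" "\<And>a. a \<in> A \<Longrightarrow> f a = \<psi> a"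
  using assms
proof (induction arbitrary: thesis rule: finite_induct)
  case empty
  then show ?case using id_GL by blast
next
  case (insert a A)
  have ind: "independent A" "a \<notin> span A"
    using insert.prems(2) insert.hyps(2) by (simp_all add: independent_insert)
  have "\<psi> a \<notin> \<psi> ` A" using insert.prems(4) insert.hyps(2) by auto
  then have ind': "independent (\<psi> ` A)" "\<psi> a \<notin> span (\<psi> ` A)"
    using insert.prems(3) by (simp_all add: independent_insert)
  obtain f where f: "f \<in> GL scale" "\<And>b. b \<in> A \<Longrightarrow> f b = \<psi> b"
    using insert.IH ind(1) ind'(1) insert.prems(4) by auto
  have "f ` A = \<psi> ` A" using f(2) by auto
  then have "f a \<notin> span (\<psi> ` A)"
    using GL_span[OF f(1), of A] GL_inj[OF f(1), of UNIV] ind(2)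
    by (auto dest: injD)
  then obtain h where h: "h \<in> GL scale" "\<And>b. b \<in> span (\<psi> ` A) \<Longrightarrow> h b = b" "h (f a) = \<psi> a"
    by (rule GL_fix_span_move[OF _ ind'(2)]) (rule that)
  have "(h \<circ> f) b = \<psi> b" if "b \<in> insert a A" for b
    using that f(2) h(2,3) by (auto simp: span_base)
  then show ?case using insert.prems(1)[OF GL_comp[OF f(1) h(1)]] by blast
qed

text \<open>A vector in only one of two subsets with equal sums would be a sum of other elements of
  \<open>A\<close>.\<close>

lemma independent_subset_sum_inj:
  assumes "finite A" "independent A" "I \<subseteq> A" "J \<subseteq> A" "\<Sum>I = \<Sum>J"
  shows "I = J"
proof -
  have aux: "I \<subseteq> J" if "I \<subseteq> A" "J \<subseteq> A" "\<Sum>I = \<Sum>J" for I J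
  proof
    fix i assume i: "i \<in> I"
    show "i \<in> J"
    proof (rule ccontr)
      assume "i \<notin> J"
      define R where "R = \<Sum>(I - {i})"
      have "\<Sum>I = i + R"
        using sum.remove[OF finite_subset[OF that(1) assms(1)] i, of "\<lambda>x. x"] by (simp only: R_def)
      then have "i = \<Sum>J + R" using that(3) add_eq_iff[of i R "\<Sum>J"] by argo
      moreover have "\<Sum>J + R \<in> span (A - {i})"
        unfolding R_def using that \<open>i \<notin> J\<close> by (intro span_add span_sum span_base) auto
      ultimately have "i \<in> span (A - {i})" by argo
      then show False using assms(2) i that(1) unfolding dependent_def by blast
    qed
  qed
  show ?thesis
    using aux[OF assms(3-5)] aux[OF assms(4,3) assms(5)[symmetric]] by (rule subset_antisym)
qed

end

section \<open>Permutation groups containing the general linear group\<close>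

locale GL_overgroup = bit_space scale
  for scale :: "bit \<Rightarrow> 'v::ab_group_add \<Rightarrow> 'v" +
  fixes G :: "('v \<Rightarrow> 'v) set"
  assumes infinite_dim: "finite A \<Longrightarrow> span A \<noteq> UNIV"
    and G_bij: "g \<in> G \<Longrightarrow> bij g"
    and G_comp: "g \<in> G \<Longrightarrow> h \<in> G \<Longrightarrow> h \<circ> g \<in> G"
    and G_inv: "g \<in> G \<Longrightarrow> inv_into UNIV g \<in> G"
    and GL_subset: "GL scale \<subseteq> G"
begin

lemma G_inj: "g \<in> G \<Longrightarrow> inj_on g S"
  using G_bij[of g] bij_is_inj[of g] inj_on_subset[of g UNIV S] by blast

lemma infinite_space: "infinite (UNIV :: 'v set)"
  using infinite_dim[of UNIV] by auto

lemma independent_of_card: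
  obtains A where "finite A" "card A = n" "independent A"
proof (induction n arbitrary: thesis)
  case 0
  then show ?case using independent_empty by (metis card.empty finite.emptyI)
next
  case (Suc n)
  obtain A where A: "finite A" "card A = n" "independent A" using Suc.IH .
  obtain s where "s \<notin> span A" using infinite_dim[OF A(1)] by blast
  then have "s \<notin> A" "independent (insert s A)" using A(3) by (auto simp: span_base independent_insertI)
  then show ?case using Suc.prems[of "insert s A"] A by simp
qed

section \<open>Homogeneity and bad points\<close>

definition good :: "'v set \<Rightarrow> bool" where
  "good T \<longleftrightarrow> (\<exists>g\<in>G. independent (g ` T))"

text \<open>By \<open>homogeneous_extend\<close> this amounts to \<open>n\<close>-transitivity of
  \<open>G\<close>.\<close>

definition homogeneous :: "nat \<Rightarrow> bool" where
  "homogeneous n \<longleftrightarrow> (\<forall>T. finite T \<longrightarrow> card T = n \<longrightarrow> good T)"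

definition bad_points :: "'v set \<Rightarrow> 'v set" where
  "bad_points A = {w. w \<notin> A \<and> \<not> good (insert w A)}"

lemma independent_imp_good: "independent T \<Longrightarrow> good T"
  using id_GL GL_subset unfolding good_def by (metis image_id id_apply subsetD)

lemma good_imageI:
  assumes "g \<in> G" "good (g ` T)"
  shows "good T"
proof -
  obtain h where h: "h \<in> G" "independent (h ` g ` T)" using assms(2) by (auto simp: good_def)
  have "h \<circ> g \<in> G" "independent ((h \<circ> g) ` T)"
    using G_comp[OF assms(1) h(1)] h(2) by (simp_all add: image_comp)
  then show ?thesis unfolding good_def by blast
qed

lemma good_image:
  assumes "g \<in> G"
  shows "good (g ` T) \<longleftrightarrow> good T"
proof
  assume "good T"
  moreover have "inv_into UNIV g ` g ` T = T"
    using G_bij[OF assms] by (simp add: image_inv_f_f bij_is_inj)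
  ultimately show "good (g ` T)" using good_imageI[OF G_inv[OF assms], of "g ` T"] by simp
qed (rule good_imageI[OF assms])

lemma bad_points_image:
  assumes "g \<in> G"
  shows "bad_points (g ` A) = g ` bad_points A"
proof -
  have inj: "inj g" and surj: "surj g" using G_bij[OF assms] by (simp_all add: bij_def)
  have "g v \<in> bad_points (g ` A) \<longleftrightarrow> v \<in> bad_points A" for v
    using good_image[OF assms, of "insert v A"] inj
    by (simp add: bad_points_def inj_image_mem_iff)
  then show ?thesis using surj by (auto simp: image_iff) (metis surjD)
qed

lemma bad_points_swap:
  assumes "w \<in> bad_points A" "a \<in> A"
  shows "a \<in> bad_points (insert w (A - {a}))"
proof -
  have "insert a (insert w (A - {a})) = insert w A" using assms(2) by auto
  then show ?thesis using assms by (auto simp: bad_points_def)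
qed

text \<open>Both \<open>A\<close> and its image are moved to independent sets, which an element of
  \<open>GL\<close> matches as prescribed; then the second move is undone.\<close>

lemma homogeneous_extend:
  assumes "homogeneous n" "finite A" "card A = n" "inj_on \<psi> A"
  obtains h where "h \<in> G" "\<And>a. a \<in> A \<Longrightarrow> h a = \<psi> a"
proof -
  have "good A" "good (\<psi> ` A)"
    using assms by (simp_all add: homogeneous_def card_image)
  then obtain g g' where g: "g \<in> G" "independent (g ` A)"
    and g': "g' \<in> G" "independent (g' ` \<psi> ` A)"
    by (auto simp: good_def)
  have inv_g: "inv_into UNIV g (g v) = v" and inv_g': "inv_into UNIV g' (g' v) = v" for v
    using G_inj[OF g(1), of UNIV] G_inj[OF g'(1), of UNIV] by simp_all
  define \<theta> where "\<theta> v = g' (\<psi> (inv_into UNIV g v))" for v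
  have \<theta>: "\<theta> (g a) = g' (\<psi> a)" for a by (simp add: \<theta>_def inv_g)
  have "\<theta> ` g ` A = g' ` \<psi> ` A" by (simp add: image_image \<theta>)
  moreover have "inj_on \<theta> (g ` A)"
    using assms(4) G_inj[OF g'(1), of UNIV] by (auto simp: inj_on_def \<theta>)
  ultimately obtain f where f: "f \<in> GL scale" "\<And>v. v \<in> g ` A \<Longrightarrow> f v = \<theta> v"
    using assms(2) g'(2) by (metis GL_extend[OF _ g(2)] finite_imageI)
  define h where "h = inv_into UNIV g' \<circ> (f \<circ> g)"
  have "h \<in> G" unfolding h_def using f(1) GL_subset by (intro G_comp G_inv g g') auto
  moreover have "h a = \<psi> a" if "a \<in> A" for a
    using that by (simp add: h_def f(2) \<theta> inv_g')
  ultimately show thesis using that by blast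
qed

section \<open>Location, uniqueness and existence of bad points\<close>

lemma bad_points_of_independent:
  assumes "independent A"
  shows "bad_points A \<subseteq> span A"
  using assms independent_imp_good independent_insertI unfolding bad_points_def by blast

text \<open>Up to \<open>G\<close>, a set of size \<open>n\<close> is independent, so it has only finitely many bad points,
  whereas \<open>GL\<close> moves every point outside the span to infinitely many others.\<close>

lemma bad_points_subset_span:
  assumes "homogeneous n" "finite A" "card A = n"
  shows "bad_points A \<subseteq> span A"
proof
  fix w assume w: "w \<in> bad_points A"
  obtain g where g: "g \<in> G" "independent (g ` A)"
    using assms by (auto simp: homogeneous_def good_def)
  have fin_span: "finite (span S)" if "finite S" for S
    unfolding span_finite_eq_subset_sums[OF that] using that by simp
  have "finite (bad_points (g ` A))"
    using finite_subset[OF bad_points_of_independent[OF g(2)] fin_span] assms(2) by simp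
  then have "finite (g ` bad_points A)" by (simp only: bad_points_image[OF g(1)])
  then have fin: "finite (bad_points A)"
    by (rule finite_imageD[OF _ G_inj[OF g(1)]])
  show "w \<in> span A"
  proof (rule ccontr)
    assume "w \<notin> span A"
    have "v \<in> bad_points A" if v: "v \<notin> span A" for v
    proof -
      obtain f where f: "f \<in> GL scale" "\<And>a. a \<in> span A \<Longrightarrow> f a = a" "f w = v"
        by (rule GL_fix_span_move[OF \<open>w \<notin> span A\<close> v]) (rule that)
      have "f ` A = A" using f(2) by (simp add: f(2) span_base)
      moreover have "f \<in> G" using f(1) GL_subset by blast
      ultimately show ?thesis using bad_points_image[of f A] w f(3) by (metis imageI)
    qed
    then have "UNIV = bad_points A \<union> span A" by blast
    moreover have "finite (bad_points A \<union> span A)" using fin fin_span assms(2) by simp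
    ultimately show False using infinite_space by simp
  qed
qed

text \<open>Exchanging \<open>w\<close> and \<open>a\<close> gives another \<open>n\<close>-set, and
  \<open>a\<close> is a bad point of it.\<close>

lemma bad_points_in_span_of_rest:
  assumes "homogeneous n" "finite A" "card A = n" "w \<in> bad_points A" "a \<in> A"
  shows "a \<in> span (insert w (A - {a}))"
proof -
  have "w \<notin> A" using assms(4) by (simp add: bad_points_def)
  then have "card (insert w (A - {a})) = n"
    using assms(2,3,5) card_Suc_Diff1[OF assms(2,5)] by simp
  moreover have "finite (insert w (A - {a}))" using assms(2) by simp
  ultimately show ?thesis
    using bad_points_subset_span[OF assms(1)] bad_points_swap[OF assms(4,5)] by blast
qed

text \<open>If \<open>w\<close> were a sum omitting some \<open>a\<close>, exchanging
  \<open>a\<close> with \<open>w\<close> would put \<open>a\<close> into the span of the other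
  elements of \<open>A\<close>.\<close>

lemma bad_point_of_independent_eq_sum:
  assumes "homogeneous n" "finite A" "card A = n" "independent A" "w \<in> bad_points A"
  shows "w = \<Sum>A"
proof -
  obtain I where I: "I \<subseteq> A" "w = \<Sum>I"
    using bad_points_of_independent[OF assms(4)] assms(2,5) span_finite_eq_subset_sums by blast
  have "a \<in> I" if "a \<in> A" for a
  proof (rule ccontr)
    assume "a \<notin> I"
    then have "w \<in> span (A - {a})" unfolding I(2) using I(1) by (intro span_sum span_base) auto
    then have "span (insert w (A - {a})) = span (A - {a})" by (rule span_redundant)
    then have "a \<in> span (A - {a})"
      using bad_points_in_span_of_rest[OF assms(1-3,5) that] by simp
    then show False using assms(4) that unfolding dependent_def by blast
  qed
  then have "I = A" using I(1) by blast
  then show ?thesis using I(2) by simp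
qed

lemma bad_point_unique:
  assumes "homogeneous n" "finite A" "card A = n" "w \<in> bad_points A" "w' \<in> bad_points A"
  shows "w = w'"
proof -
  obtain g where g: "g \<in> G" "independent (g ` A)"
    using assms by (auto simp: homogeneous_def good_def)
  have "card (g ` A) = n" using assms(3) G_inj[OF g(1)] by (simp add: card_image)
  then have "g v = \<Sum>(g ` A)" if "v \<in> bad_points A" for v
    using bad_point_of_independent_eq_sum[OF assms(1) _ _ g(2)] assms(2) that
    by (simp add: bad_points_image[OF g(1)])
  then have "g w = g w'" using assms(4,5) by simp
  then show ?thesis using G_inj[OF g(1), of UNIV] by (simp add: inj_eq)
qed

text \<open>Some set of size \<open>n + 1\<close> is not good, so some \<open>n\<close>-set has a
  bad point; transitivity on \<open>n\<close>-sets carries it to \<open>A\<close>.\<close>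

lemma bad_point_exists:
  assumes "homogeneous n" "\<not> homogeneous (Suc n)" "finite A" "card A = n"
  obtains w where "w \<in> bad_points A"
proof -
  obtain T where T: "finite T" "card T = Suc n" "\<not> good T"
    using assms(2) by (auto simp: homogeneous_def)
  then obtain t S where S: "T = insert t S" "t \<notin> S" "card S = n"
    using card_Suc_eq[of T n] by blast
  then have t: "t \<in> bad_points S" using T(3) by (simp add: bad_points_def)
  have finS: "finite S" using S(1) T(1) by simp
  then obtain \<psi> where \<psi>: "bij_betw \<psi> S A"
    using finite_same_card_bij[OF finS assms(3)] assms(4) S(3) by blast
  obtain h where h: "h \<in> G" "\<And>a. a \<in> S \<Longrightarrow> h a = \<psi> a"
    by (rule homogeneous_extend[OF assms(1) finS S(3) bij_betw_imp_inj_on[OF \<psi>]]) (rule that)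
  have "h ` S = A" using h(2) \<psi> by (simp add: bij_betw_def)
  then show thesis using that t bad_points_image[OF h(1), of S] by blast
qed

text \<open>The witness is \<open>A = X \<union> {\<Sum>X, s}\<close> with \<open>X\<close> independent and \<open>s\<close> outside its span. Its bad point
  would be \<open>s + \<Sum>I\<close> for a nonempty \<open>I \<subseteq> X\<close>, but \<open>GL\<close> induces all permutations of
  \<open>X \<union> {\<Sum>X}\<close> while fixing \<open>s\<close>, and no such point is invariant under all of them.\<close>

lemma homogeneous_step:
  assumes hom: "homogeneous n" and n: "4 \<le> n"
  shows "homogeneous (Suc n)"
proof (rule ccontr)
  assume not_hom: "\<not> homogeneous (Suc n)"
  obtain X where X: "finite X" "card X = n - 2" "independent X" by (rule independent_of_card)
  obtain s where s: "s \<notin> span X" using infinite_dim[OF X(1)] by blast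
  define k where "k = \<Sum>X"
  define Y where "Y = insert s X"
  define A where "A = insert s (insert k X)"
  have sX: "s \<notin> X" using s span_base by blast
  have k_span: "k \<in> span X" unfolding k_def by (intro span_sum span_base)
  have sk: "s \<noteq> k" using s k_span by blast
  \<comment> \<open>This is where \<open>n = 3\<close> would fail: a singleton \<open>X\<close>
    contains its own sum.\<close>
  have kX: "k \<notin> X"
  proof
    assume "k \<in> X"
    then have "{k} = X"
      using independent_subset_sum_inj[OF X(1,3), of "{k}" X] by (simp add: k_def)
    then have "card X = 1" by (metis card_1_singleton_iff One_nat_def)
    then show False using X(2) n by simp
  qed
  have Y: "finite Y" "independent Y"
    using X s by (simp_all add: Y_def independent_insertI)
  have A: "finite A" "card A = n"
    using X kX sk sX n by (simp_all add: A_def)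
  obtain t where t: "t \<in> bad_points A" by (rule bad_point_exists[OF hom not_hom A])
  have "span A = span Y"
  proof -
    have "A = insert k Y" by (auto simp: A_def Y_def)
    moreover have "k \<in> span Y" using k_span span_mono[of X Y] by (auto simp: Y_def)
    ultimately show ?thesis by (simp add: span_redundant)
  qed
  then have "t \<in> span Y" using bad_points_subset_span[OF hom A] t by blast
  then obtain J where J: "J \<subseteq> Y" "t = \<Sum>J"
    unfolding span_finite_eq_subset_sums[OF Y(1)] by blast
  \<comment> \<open>Otherwise \<open>t\<close> lies in the span of \<open>X\<close>, and exchanging
    \<open>s\<close> with \<open>t\<close> would force \<open>s\<close> into that span as
    well.\<close>
  have "s \<in> J"
  proof (rule ccontr)
    assume "s \<notin> J"
    then have "t \<in> span X" unfolding J(2) using J(1) by (intro span_sum span_base) (auto simp: Y_def)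
    then have "insert t (A - {s}) \<subseteq> span X" using k_span span_superset[of X] by (auto simp: A_def)
    then have "span (insert t (A - {s})) \<subseteq> span X" by (rule span_minimal) simp
    moreover have "s \<in> span (insert t (A - {s}))"
      by (rule bad_points_in_span_of_rest[OF hom A t]) (simp add: A_def)
    ultimately show False using s by blast
  qed
  define I where "I = J - {s}"
  have I: "I \<subseteq> X" using J(1) by (auto simp: I_def Y_def)
  have t_eq: "t = s + \<Sum>I"
    unfolding I_def J(2) by (rule sum.remove[OF finite_subset[OF J(1) Y(1)] \<open>s \<in> J\<close>])
  have "I \<noteq> {}"
    using t t_eq by (auto simp: bad_points_def A_def)
  \<comment> \<open>An automorphism preserving \<open>A\<close> permutes its bad points, hence fixes
    the only one.\<close>
  have moved: False if f: "f \<in> GL scale" "f ` A = A" "f t \<noteq> t" for f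
  proof -
    have "f \<in> G" using f(1) GL_subset by blast
    then have "f t \<in> bad_points A" using bad_points_image[of f A] t f(2) by (metis imageI)
    then show False using bad_point_unique[OF hom A _ t] f(3) by blast
  qed
  show False
  proof (cases "I = X")
    case True
    obtain x where x: "x \<in> X" using \<open>I \<noteq> {}\<close> True by blast
    have k_eq: "k = x + \<Sum>(X - {x})" unfolding k_def by (rule sum.remove[OF X(1) x])
    have "k \<notin> span (Y - {x})"
    proof
      assume "k \<in> span (Y - {x})"
      moreover have "\<Sum>(X - {x}) \<in> span (Y - {x})"
        by (intro span_sum span_base) (auto simp: Y_def)
      ultimately have "k + \<Sum>(X - {x}) \<in> span (Y - {x})" by (rule span_add)
      moreover have "k + \<Sum>(X - {x}) = x" using add_eq_iff k_eq by metis
      ultimately have "x \<in> span (Y - {x})" by simp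
      then show False using Y(2) x unfolding dependent_def Y_def by blast
    qed
    \<comment> \<open>Replacing \<open>x\<close> by \<open>k\<close> in \<open>Y\<close> leaves an
      independent set. The resulting \<open>f\<close> also sends \<open>k\<close> back to
      \<open>x\<close>, so it preserves \<open>A\<close> but moves \<open>t = s + k\<close> to
      \<open>s + x\<close>.\<close>
    define \<psi> where "\<psi> = id(x := k)"
    have "independent (insert k (Y - {x}))"
      by (rule independent_insertI[OF \<open>k \<notin> span (Y - {x})\<close> independent_mono[OF Y(2) Diff_subset]])
    moreover have "\<psi> ` Y = insert k (Y - {x})"
      using x by (auto simp: \<psi>_def Y_def)
    moreover have "inj_on \<psi> Y"
      using kX sk by (auto simp: \<psi>_def Y_def inj_on_def)
    ultimately obtain f where f: "f \<in> GL scale" "\<And>v. v \<in> Y \<Longrightarrow> f v = \<psi> v"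
      using Y by (metis GL_extend)
    have fs: "f s = s" using f(2)[of s] x sX by (auto simp: \<psi>_def Y_def)
    have "f v = \<psi> v" if "v \<in> X" for v using f(2) that by (simp add: Y_def)
    then have fX: "f ` X = insert k (X - {x})" using x by (auto simp: \<psi>_def)
    have "f k = \<Sum>(f ` X)" unfolding k_def by (rule GL_sum[OF f(1)])
    also have "\<dots> = k + \<Sum>(X - {x})" unfolding fX by (rule sum.insert) (use X(1) kX in auto)
    also have "\<dots> = x" using add_eq_iff k_eq by metis
    finally have fk: "f k = x" .
    have "f ` A = A" using fs fX fk x by (auto simp: A_def)
    moreover have "f t = s + x" "t = s + k"
      using t_eq True GL_add[OF f(1)] fs fk by (simp_all add: k_def)
    then have "f t \<noteq> t" using kX x by auto
    ultimately show False using moved f(1) by blast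
  next
    case False
    then obtain i j where ij: "i \<in> I" "j \<in> X" "j \<notin> I" using I \<open>I \<noteq> {}\<close> by blast
    have iX: "i \<in> X" using ij I by blast
    \<comment> \<open>Transposing \<open>i\<close> and \<open>j\<close> preserves \<open>X\<close>
      and hence its sum \<open>k\<close>, but not the subset \<open>I\<close>, so \<open>t\<close>
      moves.\<close>
    define \<psi> where "\<psi> = id(i := j, j := i)"
    have \<psi>X: "\<psi> ` X = X" using ij(2) iX by (auto simp: \<psi>_def image_iff)
    moreover have \<psi>s: "\<psi> s = s" using sX ij(2) iX by (auto simp: \<psi>_def)
    ultimately have "\<psi> ` Y = Y" by (simp add: Y_def)
    moreover have "inj_on \<psi> Y" by (auto simp: \<psi>_def inj_on_def)
    ultimately obtain f where f: "f \<in> GL scale" "\<And>v. v \<in> Y \<Longrightarrow> f v = \<psi> v"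
      using Y by (metis GL_extend)
    have fX_eq: "f v = \<psi> v" if "v \<in> X" for v using f(2) that by (simp add: Y_def)
    then have fX: "f ` X = X" using \<psi>X by auto
    have fs: "f s = s" using f(2)[of s] \<psi>s by (simp add: Y_def)
    have "f k = \<Sum>(f ` X)" unfolding k_def by (rule GL_sum[OF f(1)])
    then have fk: "f k = k" by (simp add: fX k_def)
    have "f ` A = A" by (simp add: A_def fs fk fX)
    moreover have "f t \<noteq> t"
    proof
      assume "f t = t"
      then have "\<Sum>(f ` I) = \<Sum>I"
        by (simp add: t_eq GL_add[OF f(1)] fs flip: GL_sum[OF f(1)])
      then have "f ` I = I"
        using independent_subset_sum_inj[OF X(1,3)] I fX by (metis image_mono)
      moreover have "f i = j" using fX_eq[OF iX] by (simp add: \<psi>_def)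
      ultimately show False using ij by (metis imageI)
    qed
    ultimately show False using moved f(1) by blast
  qed
qed

section \<open>Sets of at most three points, and the passage to all sizes\<close>

lemma span_subset_imp_homogeneous_Suc:
  assumes "homogeneous n" "finite A" "card A = n" "span A \<subseteq> A"
  shows "homogeneous (Suc n)"
proof (rule ccontr)
  assume "\<not> homogeneous (Suc n)"
  then obtain w where w: "w \<in> bad_points A" using bad_point_exists assms(1-3) by blast
  then show False
    using bad_points_subset_span[OF assms(1-3)] assms(4) by (auto simp: bad_points_def)
qed

lemma homogeneous_0: "homogeneous 0"
  using independent_imp_good[OF independent_empty] by (simp add: homogeneous_def)

text \<open>The only dependent singleton is \<open>{0}\<close>, and \<open>g\<close> moves it to an
  independent one.\<close>

lemma homogeneous_1:
  assumes "g \<in> G" "g 0 \<noteq> 0"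
  shows "homogeneous 1"
proof -
  have "good {a}" for a
  proof (cases "a = 0")
    case True
    have "independent (g ` {0})" using assms(2) by (simp add: dependent_single)
    then show ?thesis using assms(1) True unfolding good_def by blast
  next
    case False
    then show ?thesis by (intro independent_imp_good) (simp add: dependent_single)
  qed
  then show ?thesis by (auto simp: homogeneous_def card_Suc_eq)
qed

lemma homogeneous_2:
  assumes "homogeneous 1"
  shows "homogeneous 2"
  using span_subset_imp_homogeneous_Suc[OF assms, of "{0}"] by (simp add: numeral_2_eq_2)

lemma homogeneous_3:
  assumes "homogeneous 2"
  shows "homogeneous 3"
proof -
  obtain x :: 'v where "x \<noteq> 0"
    using infinite_space by (metis finite.simps ex_new_if_finite singletonI)
  moreover have "span {0, x} \<subseteq> {0, x}"
    by (auto simp: span_insert_iff)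
  ultimately show ?thesis
    using span_subset_imp_homogeneous_Suc[OF assms, of "{0, x}"] by (simp add: numeral_3_eq_3)
qed

lemma homogeneous_all:
  assumes "homogeneous 1" "homogeneous 4"
  shows "homogeneous n"
proof (cases "4 \<le> n")
  case True
  then show ?thesis using assms(2) homogeneous_step by (rule dec_induct)
next
  case False
  then consider "n = 0" | "n = 1" | "n = 2" | "n = 3" by linarith
  then show ?thesis
    using homogeneous_0 assms(1) homogeneous_2 homogeneous_3 by cases simp_all
qed

section \<open>The affine case\<close>

text \<open>The three points may be dependent, so all sums in their span are checked. If
  \<open>w\<close> is a sum of two of them, exchange forces the third to be \<open>0\<close>; if
  \<open>w = 0\<close>, it forces \<open>x = y + z\<close>. The formula holds in each case.\<close>

lemma bad_point_of_three:
  assumes hom: "homogeneous 3" and dist: "x \<noteq> y" "y \<noteq> z" "x \<noteq> z"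
    and w: "w \<in> bad_points {x, y, z}"
  shows "w = x + y + z"
proof -
  have A: "finite {x, y, z}" "card {x, y, z} = 3" using dist by simp_all
  have diffs: "{x, y, z} - {x} = {y, z}" "{x, y, z} - {y} = {x, z}" "{x, y, z} - {z} = {x, y}"
    using dist by auto
  have in_rest: "x \<in> span {w, y, z}" "y \<in> span {w, x, z}" "z \<in> span {w, x, y}"
    using bad_points_in_span_of_rest[OF hom A w] diffs by (metis insertCI)+
  have nw: "w \<noteq> x" "w \<noteq> y" "w \<noteq> z" using w by (auto simp: bad_points_def)
  have redundant: "c = 0"
    if "w = a + b" "c \<in> span {w, a, b}" "c \<noteq> a" "c \<noteq> b" "w \<noteq> c" for a b c
  proof -
    have "w \<in> span {a, b}" using that(1) by (simp add: span_pair)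
    then have "c \<in> span {a, b}" using that(2) span_redundant by blast
    then show ?thesis using that(1,3-5) span_pair by blast
  qed
  have "w \<in> span {x, y, z}" using bad_points_subset_span[OF hom A] w by blast
  then consider "w = 0" | "w = x + y" | "w = x + z" | "w = y + z" | "w = x + y + z"
    using nw unfolding span_triple by blast
  then show ?thesis
  proof cases
    case 1
    then have "x = y + z" using in_rest(1) nw(1) dist by (auto simp: span_pair)
    then show ?thesis using 1 by (simp add: add.assoc)
  next
    case 2
    then show ?thesis using redundant[OF 2 in_rest(3)] dist nw by simp
  next
    case 3
    then show ?thesis using redundant[OF 3 in_rest(2)] dist nw by simp
  next
    case 4
    then show ?thesis using redundant[OF 4 in_rest(1)] dist nw by simp
  qed
qed

text \<open>For distinct nonzero \<open>x\<close> and \<open>y\<close>, the bad point of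
  \<open>{x, y, 0}\<close> is \<open>x + y\<close>, and \<open>g\<close> carries it to the bad point
  of the image set.\<close>

lemma not_homogeneous_4_imp_affine:
  assumes "homogeneous 3" "\<not> homogeneous 4" "g \<in> G"
  shows "g (x + y) = g x + g y + g 0"
proof -
  consider "x = 0" | "y = 0" | "x = y" | "x \<noteq> y" "y \<noteq> 0" "x \<noteq> 0" by blast
  then show ?thesis
  proof cases
    case 4
    have A: "finite {x, y, 0}" "card {x, y, 0} = 3" using 4 by simp_all
    have "\<not> homogeneous (Suc 3)" using assms(2) by simp
    then obtain w where w: "w \<in> bad_points {x, y, 0}"
      using bad_point_exists[OF assms(1) _ A] by blast
    then have "x + y \<in> bad_points {x, y, 0}"
      using bad_point_of_three[OF assms(1) 4 w] by simp
    then have "g (x + y) \<in> bad_points (g ` {x, y, 0})"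
      unfolding bad_points_image[OF assms(3)] by (rule imageI)
    moreover have "g x \<noteq> g y" "g y \<noteq> g 0" "g x \<noteq> g 0"
      using 4 G_inj[OF assms(3), of UNIV] by (simp_all add: inj_eq)
    ultimately show ?thesis
      by (intro bad_point_of_three[OF assms(1)]) simp_all
  qed (simp_all add: add.assoc add.commute[of "g 0"])
qed

lemma affine_imp_linear_part_GL:
  assumes "g \<in> G" "\<And>x y. g (x + y) = g x + g y + g 0"
  shows "(\<lambda>v. g v + g 0) \<in> GL scale"
proof -
  have "Vector_Spaces.linear scale scale (\<lambda>v. g v + g 0)"
    by (rule additive_imp_linear) (simp add: assms(2) ac_simps)
  moreover have "bij (\<lambda>v. v + g 0)"
    by (rule involuntory_imp_bij) (simp add: add.assoc)
  then have "bij ((\<lambda>v. v + g 0) \<circ> g)"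
    using G_bij[OF assms(1)] bij_comp by blast
  ultimately show ?thesis by (simp add: GL_def o_def)
qed

text \<open>Transitivity on points gives \<open>g\<close> with \<open>g 0 = a\<close>. Its linear
  part \<open>f\<close> lies in \<open>GL\<close>, hence in \<open>G\<close>, and cancelling it
  leaves the translation by \<open>a\<close>.\<close>

lemma affine_imp_translation_in_G:
  assumes "homogeneous 1" "\<And>g x y. g \<in> G \<Longrightarrow> g (x + y) = g x + g y + g 0"
  shows "(\<lambda>v. v + a) \<in> G"
proof -
  obtain g where g: "g \<in> G" "g 0 = a"
    using homogeneous_extend[OF assms(1), of "{0}" "\<lambda>_. a"] by auto
  define f where "f v = g v + a" for v
  have "f \<in> G"
    using affine_imp_linear_part_GL[OF g(1) assms(2)[OF g(1)]] GL_subset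
    by (auto simp: f_def[abs_def] g(2))
  then have "g \<circ> inv_into UNIV f \<in> G" by (intro G_comp G_inv g)
  moreover have "(g \<circ> inv_into UNIV f) v = v + a" for v
  proof -
    have "f (inv_into UNIV f v) = v" using G_bij[OF \<open>f \<in> G\<close>] by (simp add: bij_is_surj surj_f_inv_f)
    then show ?thesis by (simp add: f_def add_eq_iff)
  qed
  ultimately show ?thesis by (metis (no_types) ext)
qed

end

section \<open>Translation to the group \<open>Sym\<close>, and the classification\<close>

lemma (in vector_space) infinite_independent_imp_span_neq_UNIV:
  assumes "independent B" "infinite B" "finite A"
  shows "span A \<noteq> UNIV"
  using independent_span_bound[OF assms(3,1)] assms(2) by blast

lemma carrier_Sym: "carrier Sym = {f. bij f}"
  by (simp add: BijGroup_def Bij_def)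

lemma mult_Sym:
  assumes "bij f" "bij g"
  shows "f \<otimes>\<^bsub>Sym\<^esub> g = f \<circ> g"
  using assms by (simp add: BijGroup_def Bij_def compose_def fun_eq_iff)

lemma inv_Sym:
  assumes "bij f"
  shows "inv\<^bsub>Sym\<^esub> f = inv_into UNIV f"
  using assms inv_BijGroup[of f UNIV] by (simp add: Bij_def restrict_def)

theorem theorem2p5:
  fixes scale :: "bit \<Rightarrow> 'v::ab_group_add \<Rightarrow> 'v"
    and G :: "('v \<Rightarrow> 'v) set"
  assumes "countably_infinite_dimensional scale"
    and "subgroup G Sym"
    and "closed_in_Sym G"
    and "GL scale \<subset> G"
    and "\<not> (\<forall>g\<in>G. g 0 = 0)"
  shows "G = AGL scale \<or> G = carrier Sym"
proof -
  interpret vector_space scale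
    using assms(1) by (simp add: countably_infinite_dimensional_def)
  obtain B where B: "independent B" "infinite B"
    using assms(1) by (auto simp: countably_infinite_dimensional_def)
  have bij: "bij g" if "g \<in> G" for g
    using subgroup.subset[OF assms(2)] that by (auto simp: carrier_Sym)
  interpret GL_overgroup scale G
  proof
    fix A :: "'v set" assume "finite A"
    then show "span A \<noteq> UNIV" using infinite_independent_imp_span_neq_UNIV B by blast
  next
    fix g h assume "g \<in> G" "h \<in> G"
    then show "h \<circ> g \<in> G"
      using subgroup.m_closed[OF assms(2), of h g] bij by (simp add: mult_Sym)
  next
    fix g assume "g \<in> G"
    then show "inv_into UNIV g \<in> G"
      using subgroup.m_inv_closed[OF assms(2), of g] bij by (simp add: inv_Sym)
  next
    show "GL scale \<subseteq> G" using assms(4) by blast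
  qed (rule bij)
  have hom1: "homogeneous 1" using assms(5) homogeneous_1 by blast
  show ?thesis
  \<comment> \<open>Sizes up to \<open>3\<close> are homogeneous in either case, so the dichotomy is
    decided at size \<open>4\<close>.\<close>
  proof (cases "homogeneous 4")
    case True
    have "\<pi> \<in> G" if "\<pi> \<in> carrier Sym" for \<pi>
    proof -
      \<comment> \<open>Transitivity on sets of size \<open>card S\<close> interpolates \<pi> on
        \<open>S\<close>; closedness then puts \<pi> into \<open>G\<close>.\<close>
      have "\<exists>\<sigma>\<in>G. \<forall>x\<in>S. \<sigma> x = \<pi> x" if "finite S" for S
      proof -
        have "inj_on \<pi> S"
          using \<open>\<pi> \<in> carrier Sym\<close> inj_on_subset[of \<pi> UNIV S] by (simp add: carrier_Sym bij_def)
        then show ?thesis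
          using homogeneous_extend[OF homogeneous_all[OF hom1 True] that refl] by metis
      qed
      then show ?thesis using assms(3) that unfolding closed_in_Sym_def by blast
    qed
    then show ?thesis using subgroup.subset[OF assms(2)] by blast
  next
    case False
    then have affine: "g (x + y) = g x + g y + g 0" if "g \<in> G" for g x y
      using not_homogeneous_4_imp_affine[OF homogeneous_3[OF homogeneous_2[OF hom1]]] that by blast
    have "G \<subseteq> AGL scale"
    proof
      fix g assume g: "g \<in> G"
      have t: "(\<lambda>v. v + g 0) \<in> G" using affine_imp_translation_in_G[OF hom1 affine] .
      have f: "(\<lambda>v. g v + g 0) \<in> GL scale"
        using affine_imp_linear_part_GL[OF g affine[OF g]] .
      \<comment> \<open>Here \<open>g\<close> is written as its linear part followed by the
        translation by \<open>g 0\<close>.\<close>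
      have "(\<lambda>v. v + g 0) \<otimes>\<^bsub>Sym\<^esub> (\<lambda>v. g v + g 0) \<in> AGL scale"
        unfolding AGL_def
        by (intro generate.eng generate.incl) (use f in \<open>auto simp: translation_maps_def\<close>)
      moreover have "(\<lambda>v. v + g 0) \<otimes>\<^bsub>Sym\<^esub> (\<lambda>v. g v + g 0) = g"
        using f t bij GL_subset by (subst mult_Sym) (auto simp: fun_eq_iff add.assoc)
      ultimately show "g \<in> AGL scale" by simp
    qed
    moreover have "AGL scale \<subseteq> G"
      unfolding AGL_def
    proof (rule group.generate_subgroup_incl[OF group_BijGroup _ assms(2)])
      show "GL scale \<union> translation_maps \<subseteq> G"
        using GL_subset affine_imp_translation_in_G[OF hom1 affine]
        by (auto simp: translation_maps_def)
    qed
    ultimately show ?thesis by blast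
  qed
qed

end
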